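(* Let $(Y_{12},X_{12})$ be a random pair with $Y_{12}$ real and $X_{12}$ taking values in a compact rectangle $\mathcal X\subset\mathbb R^d$, let $Q=E[X_{12}X_{12}']$ be nonsingular, and let $\beta_*=Q^{-1}E[X_{12}Y_{12}]$, $\varepsilon_{12}=Y_{12}-X_{12}'\beta_*$ and $\Delta(x)=E[\varepsilon_{12}\mathbf 1\{X_{12}\preceq x\}]$. Suppose $E|\varepsilon_{12}|<\infty$. Then $$H_0:\quad E[Y_{12}\mid X_{12}]=X_{12}'\beta_*\ \text{ almost surely}$$ holds if and only if $\Delta(x)=0$ for every $x\in\mathbb R^d$.
   Context: $a\preceq b$ denotes coordinatewise inequality between vectors, and a prime denotes transposition. In the paper, $(Y_{12},X_{12}')'=Z_{12}$ is one observation of an undirected dyadic array whose entries are identically distributed. *)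

theory Defs
  imports "HOL-Probability.Probability"
begin

definition moment_matrix :: "'a measure \<Rightarrow> ('a \<Rightarrow> real ^ 'd) \<Rightarrow> real ^ 'd ^ 'd" where
  "moment_matrix M X = (\<integral>\<omega>. (\<chi> i j. X \<omega> $ i * X \<omega> $ j) \<partial>M)"

definition beta_star :: "'a measure \<Rightarrow> ('a \<Rightarrow> real) \<Rightarrow> ('a \<Rightarrow> real ^ 'd) \<Rightarrow> real ^ 'd" where
  "beta_star M Y X = matrix_inv (moment_matrix M X) *v (\<integral>\<omega>. Y \<omega> *\<^sub>R X \<omega> \<partial>M)"

definition residual :: "'a measure \<Rightarrow> ('a \<Rightarrow> real) \<Rightarrow> ('a \<Rightarrow> real ^ 'd) \<Rightarrow> 'a \<Rightarrow> real" where
  "residual M Y X \<omega> = Y \<omega> - X \<omega> \<bullet> beta_star M Y X"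

text \<open>The library order on \<^typ>\<open>real ^ 'd\<close> is the coordinatewise one.\<close>

definition Delta :: "'a measure \<Rightarrow> ('a \<Rightarrow> real) \<Rightarrow> ('a \<Rightarrow> real ^ 'd) \<Rightarrow> real ^ 'd \<Rightarrow> real" where
  "Delta M Y X x = (\<integral>\<omega>. residual M Y X \<omega> * indicator {\<omega>. X \<omega> \<le> x} \<omega> \<partial>M)"

text \<open>Conditioning on \<open>X\<close> is conditioning on the \<open>\<sigma>\<close>-algebra generated by \<open>X\<close>.
  The function \<^const>\<open>real_cond_exp\<close> is meaningful only for integrable \<open>Y\<close>; for bounded \<open>X\<close> this
  is equivalent to integrability of the residual.\<close>

definition H0 :: "'a measure \<Rightarrow> ('a \<Rightarrow> real) \<Rightarrow> ('a \<Rightarrow> real ^ 'd) \<Rightarrow> bool" where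
  "H0 M Y X \<longleftrightarrow>
    (AE \<omega> in M. real_cond_exp M (vimage_algebra (space M) X borel) Y \<omega> = X \<omega> \<bullet> beta_star M Y X)"

end

theory Submission imports Defs begin

text \<open>Conditional expectation given \<open>X\<close> is characterised by its integrals over the sets
  \<open>{X \<in> B}\<close>, so the null hypothesis says that the finite signed measure
  \<open>B \<mapsto> E[\<epsilon> 1{X \<in> B}]\<close> vanishes. The lower orthants are an intersection-stable generator of
  the Borel sets, so it suffices that this signed measure vanishes on them and has total mass
  zero; the total mass is its value on the orthant below the upper corner of the rectangle.\<close>

lemma set_integral_vimage_eq_0_of_atMost:
  fixes X :: "'a \<Rightarrow> 'b :: ordered_euclidean_space" and f :: "'a \<Rightarrow> real"
  assumes X [measurable]: "X \<in> borel_measurable M" and f: "integrable M f"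
    and total: "(LINT \<omega>|M. f \<omega>) = 0"
    and orthant: "\<And>x. (LINT \<omega>:X -` {..x} \<inter> space M|M. f \<omega>) = 0"
    and B: "B \<in> sets borel"
  shows "(LINT \<omega>:X -` B \<inter> space M|M. f \<omega>) = 0"
proof -
  let ?G = "range (\<lambda>a :: 'b. {..a})"
  have gen: "sets borel = sigma_sets UNIV ?G"
    unfolding borel_eq_atMost by simp
  have int: "set_integrable M (X -` A \<inter> space M) f" if "A \<in> sets borel" for A
    using that f unfolding set_integrable_def
    by (intro integrable_mult_indicator) auto
  have "Int_stable ?G"
  proof (rule Int_stableI)
    fix a b assume "a \<in> ?G" "b \<in> ?G"
    then obtain x y where "a = {..x}" "b = {..y}" by auto
    \<comment> \<open>In this order \<open>inf\<close> is the coordinatewise minimum, so two lower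
      orthants meet in a lower orthant.\<close>
    then have "a \<inter> b = {..inf x y}" by auto
    then show "a \<inter> b \<in> ?G" by auto
  qed
  moreover have "?G \<subseteq> Pow UNIV" by simp
  moreover have "B \<in> sigma_sets UNIV ?G" using B gen by simp
  ultimately show ?thesis
  proof (induction rule: sigma_sets_induct_disjoint)
    case (basic A)
    then show ?case using orthant by auto
  next
    case empty
    then show ?case by (simp add: set_lebesgue_integral_def)
  next
    case (compl A)
    then have A: "A \<in> sets borel" using gen by simp
    \<comment> \<open>\<open>total\<close> enters here: \<open>UNIV\<close> is not one of the
      orthants, and the mass of a complement is the total mass minus that of
      \<open>A\<close>.\<close>
    have "X -` A \<inter> space M \<union> X -` (UNIV - A) \<inter> space M = space M" by auto
    then have "(LINT \<omega>:X -` A \<inter> space M|M. f \<omega>) + (LINT \<omega>:X -` (UNIV - A) \<inter> space M|M. f \<omega>)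
        = (LINT \<omega>:space M|M. f \<omega>)"
      using A by (subst set_integral_Un [symmetric]) (auto intro!: int)
    then show ?case using compl.IH f total by (simp add: set_integral_space)
  next
    case (union A)
    then have A: "A i \<in> sets borel" for i using gen by auto
    then have UA: "(\<Union>i. A i) \<in> sets borel" by auto
    have vU: "X -` (\<Union>i. A i) \<inter> space M = (\<Union>i. X -` A i \<inter> space M)" by auto
    \<comment> \<open>Preimages of disjoint sets are disjoint, and integrability over the whole
      union makes the signed masses countably additive.\<close>
    have "(LINT \<omega>:(\<Union>i. X -` A i \<inter> space M)|M. f \<omega>)
        = (\<Sum>i. LINT \<omega>:X -` A i \<inter> space M|M. f \<omega>)"
    proof (rule lebesgue_integral_countable_add)
      show "X -` A i \<inter> space M \<in> sets M" for i using A by simp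
      show "(X -` A i \<inter> space M) \<inter> (X -` A j \<inter> space M) = {}" if "i \<noteq> j" for i j
        using union.hyps(1) that by (auto simp: disjoint_family_on_def)
      show "set_integrable M (\<Union>i. X -` A i \<inter> space M) f"
        using int [OF UA] vU by simp
    qed
    then show ?case unfolding vU using union.IH by simp
  qed
qed

theorem lemma1:
  fixes M :: "'a measure" and Y :: "'a \<Rightarrow> real" and X :: "'a \<Rightarrow> real ^ 'd" and l u :: "real ^ 'd"
  assumes "prob_space M"
    and "Y \<in> borel_measurable M" and "X \<in> borel_measurable M"
    and "\<And>\<omega>. \<omega> \<in> space M \<Longrightarrow> X \<omega> \<in> cbox l u"
    and "invertible (moment_matrix M X)"
    and "integrable M (residual M Y X)"
  shows "H0 M Y X \<longleftrightarrow> (\<forall>x. Delta M Y X x = 0)"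
proof -
  interpret prob_space M by fact
  note [measurable] = assms(2,3)
  define \<beta> where "\<beta> = beta_star M Y X"
  define F where "F = vimage_algebra (space M) X borel"
  let ?e = "residual M Y X" and ?g = "\<lambda>\<omega>. X \<omega> \<bullet> \<beta>"
  have e_def: "?e \<omega> = Y \<omega> - ?g \<omega>" for \<omega>
    by (simp add: residual_def \<beta>_def)
  \<comment> \<open>The preimages already form a \<sigma>-algebra, so each event of \<open>F\<close>
    is literally a preimage of a Borel set.\<close>
  have setsF: "sets F = {X -` B \<inter> space M |B. B \<in> sets borel}"
    unfolding F_def by (rule sets_vimage_algebra2) simp
  have sub: "subalgebra M F"
    unfolding subalgebra_def setsF by (auto simp: F_def)
  interpret sigma_finite_subalgebra M F
    by (rule finite_measure_subalgebra_is_sigma_finite)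
       (unfold_locales, rule sub)
  have XF: "X \<in> borel_measurable F"
    unfolding F_def by (rule measurable_vimage_algebra1) simp
  \<comment> \<open>The rectangle bounds \<open>X\<close>, and Cauchy-Schwarz then bounds
    \<open>?g\<close>. Adding \<open>?g\<close> to the integrable residual gives the integrability
    of \<open>Y\<close>, on which the meaning of \<open>real_cond_exp\<close> depends.\<close>
  have g_int: "integrable M ?g"
  proof -
    obtain C where C: "\<And>x. x \<in> cbox l u \<Longrightarrow> norm x \<le> C"
      using bounded_cbox [of l u] by (auto simp: bounded_iff)
    have "norm (?g \<omega>) \<le> C * norm \<beta>" if "\<omega> \<in> space M" for \<omega>
      using Cauchy_Schwarz_ineq2 [of "X \<omega>" \<beta>] C [OF assms(4) [OF that]]
      by (metis mult_right_mono norm_ge_zero order_trans real_norm_def)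
    then show ?thesis
      by (intro integrable_const_bound [where B = "C * norm \<beta>"]) auto
  qed
  have Y_int: "integrable M Y"
    using Bochner_Integration.integrable_add [OF assms(6) g_int] by (simp add: e_def)
  have seti: "set_integrable M A h" if "A \<in> sets M" "integrable M h" for A and h :: "'a \<Rightarrow> real"
    using that unfolding set_integrable_def by (intro integrable_mult_indicator)
  \<comment> \<open>Vanishing residual mass on \<open>A\<close> thus means that \<open>Y\<close> and
    \<open>?g\<close> have equal integrals over \<open>A\<close>, which is the form in which
    conditional expectation is characterised.\<close>
  have diff: "(LINT \<omega>:A|M. ?e \<omega>) = (LINT \<omega>:A|M. Y \<omega>) - (LINT \<omega>:A|M. ?g \<omega>)"
    if "A \<in> sets M" for A
    unfolding e_def by (rule set_integral_diff) (intro seti that Y_int g_int)+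
  have Delta_eq: "Delta M Y X x = (LINT \<omega>:X -` {..x} \<inter> space M|M. ?e \<omega>)" for x
    unfolding Delta_def set_lebesgue_integral_def
    by (rule Bochner_Integration.integral_cong) (auto simp: indicator_def)
  show ?thesis
  proof
    assume "H0 M Y X"
    then have H: "AE \<omega> in M. real_cond_exp M F Y \<omega> = ?g \<omega>"
      by (simp add: H0_def F_def \<beta>_def)
    show "\<forall>x. Delta M Y X x = 0"
    proof
      fix x
      let ?A = "X -` {..x} \<inter> space M"
      have "{..x} \<in> sets borel"
        unfolding borel_eq_atMost by (auto intro: sigma_sets.Basic)
      then have "?A \<in> sets F" unfolding setsF by blast
      then have "(LINT \<omega>:?A|M. Y \<omega>) = (LINT \<omega>:?A|M. real_cond_exp M F Y \<omega>)"
        by (rule real_cond_exp_intA [OF Y_int])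
      also have "\<dots> = (LINT \<omega>:?A|M. ?g \<omega>)"
        using H unfolding set_lebesgue_integral_def
        by (intro integral_cong_AE) auto
      finally show "Delta M Y X x = 0" by (simp add: Delta_eq diff)
    qed
  next
    assume D: "\<forall>x. Delta M Y X x = 0"
    have "X -` {..u} \<inter> space M = space M"
      using assms(4) by (auto simp: cbox_interval)
    then have total: "(LINT \<omega>|M. ?e \<omega>) = 0"
      using D Delta_eq [of u] assms(6) by (simp add: set_integral_space)
    have "(LINT \<omega>:A|M. Y \<omega>) = (LINT \<omega>:A|M. ?g \<omega>)" if A: "A \<in> sets F" for A
    proof -
      obtain B where "B \<in> sets borel" "A = X -` B \<inter> space M"
        using A unfolding setsF by auto
      then have "(LINT \<omega>:A|M. ?e \<omega>) = 0"
        using set_integral_vimage_eq_0_of_atMost [OF assms(3,6) total] D Delta_eq by simp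
      then show ?thesis using diff A sub by (auto simp: subalgebra_def)
    qed
    \<comment> \<open>Uniqueness of conditional expectation: \<open>?g\<close> is
      \<open>F\<close>-measurable, being a function of \<open>X\<close>, and is integrable with the
      same integrals as \<open>Y\<close> over all of \<open>F\<close>.\<close>
    then have "AE \<omega> in M. real_cond_exp M F Y \<omega> = ?g \<omega>"
      by (rule real_cond_exp_charact) (use Y_int g_int XF in auto)
    then show "H0 M Y X" by (simp add: H0_def F_def \<beta>_def)
  qed
qed

end
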